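(* Let $G$ be a finite group, let $\mathcal{H}(G)$ be its subgroup lattice, and let $\mu_{\mathcal{H}(G)}$ be the Möbius function of $\mathcal{H}(G)$. For every subgroup $K\leq G$ put $b_G(K):=\sum_{K\leq H\leq G}\frac{1}{|H|}$. Then for every subgroup $K\leq G$, $$\frac{1}{|K|}=\sum_{K\leq H\leq G}\mu_{\mathcal{H}(G)}(K,H)\,b_G(H).$$
   Context: $\mathcal{H}(G)$ is the finite poset of all subgroups of $G$ ordered by inclusion. Its Möbius function is defined for $K\le H$ by $\mu_{\mathcal{H}(G)}(K,K)=1$ and $\sum_{K\le L\le H}\mu_{\mathcal{H}(G)}(K,L)=0$ for $K<H$. Sums over $K\le H\le G$ range over all subgroups $H$ of $G$ containing $K$. *)

theory Defs
  imports "HOL-Algebra.Algebra"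
begin

definition subgroup_lattice :: "('a, 'b) monoid_scheme \<Rightarrow> 'a set gorder" where
  "subgroup_lattice G = \<lparr>carrier = {H. subgroup H G}, eq = (=), le = (\<subseteq>)\<rparr>"

lemma partial_order_subgroup_lattice: "group G \<Longrightarrow> partial_order (subgroup_lattice G)"
  unfolding subgroup_lattice_def by (rule group.subgroups_partial_order)

lemma finite_subgroup_lattice: "finite (carrier G) \<Longrightarrow> finite (carrier (subgroup_lattice G))"
  unfolding subgroup_lattice_def
  by (auto intro!: finite_subset[of _ "Pow (carrier G)"] dest: subgroup.subset)

text \<open>
  The sum condition \<open>(\<Sum>x \<le> z \<le> y. \<mu> x z) = 0\<close> for \<open>x < y\<close> is solved for its top term
  \<open>\<mu> x y\<close>, which makes it a recursion; \<open>mobius_sum\<close> below recovers it. The value is \<open>0\<close>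
  outside the intervals of a finite partial order.
\<close>

function mobius :: "('c, 'd) gorder_scheme \<Rightarrow> 'c \<Rightarrow> 'c \<Rightarrow> int" where
  "mobius P x y =
    (if partial_order P \<and> finite (carrier P) \<and> x \<in> carrier P \<and> y \<in> carrier P \<and> x \<sqsubseteq>\<^bsub>P\<^esub> y
     then if x = y then 1
          else - (\<Sum>z \<in> {z \<in> carrier P. x \<sqsubseteq>\<^bsub>P\<^esub> z \<and> z \<sqsubset>\<^bsub>P\<^esub> y}. mobius P x z)
     else 0)"
  by auto

termination
proof (relation "measure (\<lambda>(P, x, y). card {z \<in> carrier P. z \<sqsubset>\<^bsub>P\<^esub> y})", goal_cases)
  case 1
  show ?case by simp
next
  case (2 P x y z)
  then interpret partial_order P by simp
  from 2 have fin: "finite (carrier P)" and y: "y \<in> carrier P"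
    and z: "z \<in> carrier P" "z \<sqsubset>\<^bsub>P\<^esub> y" by auto
  have "w \<sqsubset>\<^bsub>P\<^esub> y" if "w \<in> carrier P" "w \<sqsubset>\<^bsub>P\<^esub> z" for w
    using lless_trans[OF that(2) z(2) that(1) z(1) y] .
  moreover have "\<not> z \<sqsubset>\<^bsub>P\<^esub> z" by (simp add: lless_eq)
  ultimately have "{w \<in> carrier P. w \<sqsubset>\<^bsub>P\<^esub> z} \<subset> {w \<in> carrier P. w \<sqsubset>\<^bsub>P\<^esub> y}"
    using z by blast
  then show ?case using fin by (simp add: psubset_card_mono)
qed

declare mobius.simps [simp del]

lemma mobius_refl:
  assumes "partial_order P" "finite (carrier P)" "x \<in> carrier P"
  shows "mobius P x x = 1"
proof -
  interpret partial_order P by fact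
  show ?thesis using assms by (simp add: mobius.simps)
qed

lemma mobius_sum:
  assumes "partial_order P" "finite (carrier P)" "x \<in> carrier P" "y \<in> carrier P" "x \<sqsubset>\<^bsub>P\<^esub> y"
  shows "(\<Sum>z \<in> {z \<in> carrier P. x \<sqsubseteq>\<^bsub>P\<^esub> z \<and> z \<sqsubseteq>\<^bsub>P\<^esub> y}. mobius P x z) = 0"
proof -
  interpret partial_order P by fact
  have xy: "x \<sqsubseteq>\<^bsub>P\<^esub> y" "x \<noteq> y" using assms(5) by (auto simp: lless_eq)
  let ?S = "{z \<in> carrier P. x \<sqsubseteq>\<^bsub>P\<^esub> z \<and> z \<sqsubset>\<^bsub>P\<^esub> y}"
  have "{z \<in> carrier P. x \<sqsubseteq>\<^bsub>P\<^esub> z \<and> z \<sqsubseteq>\<^bsub>P\<^esub> y} = insert y ?S"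
    using assms(4) xy by (auto simp: lless_eq)
  moreover have "y \<notin> ?S" "finite ?S" using assms(2) by (auto simp: lless_eq)
  moreover have "mobius P x y = - (\<Sum>z \<in> ?S. mobius P x z)"
    by (subst mobius.simps) (use assms xy in auto)
  ultimately show ?thesis by simp
qed

definition b_sub :: "('a, 'b) monoid_scheme \<Rightarrow> 'a set \<Rightarrow> rat" where
  "b_sub G K = (\<Sum>H \<in> {H. subgroup H G \<and> K \<subseteq> H}. 1 / of_nat (card H))"

end

theory Submission
  imports Defs
begin

text \<open>
  By the definition of \<open>b_sub\<close>, the identity is Moebius inversion from above in the subgroup
  lattice, applied to the function \<open>H \<mapsto> 1/|H|\<close>. Since \<open>b_sub\<close> sums over the subgroups above its
  argument, exchanging the two summations collects, for each subgroup \<open>L\<close> above \<open>K\<close>, the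
  coefficient \<open>\<Sum> \<mu>(K,H)\<close> over \<open>K \<subseteq> H \<subseteq> L\<close>. The defining equation of the Moebius function
  (\<open>mobius_sum_interval\<close>) makes this coefficient \<open>1\<close> for \<open>L = K\<close> and \<open>0\<close> otherwise. This
  argument takes place in any finite partial order, and \<open>mobius_inversion_above\<close> records it
  in that form.
\<close>

lemma mobius_sum_interval:
  assumes "partial_order P" "finite (carrier P)" "x \<in> carrier P" "y \<in> carrier P" "x \<sqsubseteq>\<^bsub>P\<^esub> y"
  shows "(\<Sum>z \<in> {z \<in> carrier P. x \<sqsubseteq>\<^bsub>P\<^esub> z \<and> z \<sqsubseteq>\<^bsub>P\<^esub> y}. mobius P x z) = (if y = x then 1 else 0)"
proof (cases "y = x")
  case True
  interpret partial_order P by fact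
  have "{z \<in> carrier P. x \<sqsubseteq>\<^bsub>P\<^esub> z \<and> z \<sqsubseteq>\<^bsub>P\<^esub> x} = {x}"
    using assms(3) by (auto intro: le_antisym)
  then show ?thesis using True mobius_refl[OF assms(1-3)] by simp
next
  case False
  interpret partial_order P by fact
  have "x \<sqsubset>\<^bsub>P\<^esub> y" using False assms(5) by (auto simp: lless_eq)
  then show ?thesis using False mobius_sum[OF assms(1-4)] by simp
qed

text \<open>
  Both iterated sums range over the chains \<open>x \<sqsubseteq> y \<sqsubseteq> z\<close>. In the exchanged order the inner sum
  runs over the second argument of \<open>\<mu>\<close>, the one in which the recursion for \<open>\<mu>\<close> is given.
\<close>

lemma mobius_inversion_above:
  fixes f :: "'c \<Rightarrow> 'r :: ring_1"
  assumes P: "partial_order P" "finite (carrier P)" and x: "x \<in> carrier P"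
  shows "(\<Sum>y \<in> {y \<in> carrier P. x \<sqsubseteq>\<^bsub>P\<^esub> y}.
           of_int (mobius P x y) * (\<Sum>z \<in> {z \<in> carrier P. y \<sqsubseteq>\<^bsub>P\<^esub> z}. f z)) = f x"
proof -
  interpret partial_order P by fact
  let ?U = "\<lambda>y. {z \<in> carrier P. y \<sqsubseteq>\<^bsub>P\<^esub> z}"
  let ?I = "\<lambda>z. {y \<in> carrier P. x \<sqsubseteq>\<^bsub>P\<^esub> y \<and> y \<sqsubseteq>\<^bsub>P\<^esub> z}"
  have fin: "finite (?U x)" using P(2) by simp
  have "(\<Sum>y \<in> ?U x. of_int (mobius P x y) * (\<Sum>z \<in> ?U y. f z))
      = (\<Sum>y \<in> ?U x. \<Sum>z \<in> {z \<in> ?U x. y \<sqsubseteq>\<^bsub>P\<^esub> z}. of_int (mobius P x y) * f z)"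
  proof (rule sum.cong[OF HOL.refl])
    fix y assume "y \<in> ?U x"
    then have "?U y = {z \<in> ?U x. y \<sqsubseteq>\<^bsub>P\<^esub> z}" using x by (auto intro: le_trans)
    then show "of_int (mobius P x y) * (\<Sum>z \<in> ?U y. f z)
        = (\<Sum>z \<in> {z \<in> ?U x. y \<sqsubseteq>\<^bsub>P\<^esub> z}. of_int (mobius P x y) * f z)"
      by (simp add: sum_distrib_left)
  qed
  also have "\<dots> = (\<Sum>z \<in> ?U x. \<Sum>y \<in> {y \<in> ?U x. y \<sqsubseteq>\<^bsub>P\<^esub> z}. of_int (mobius P x y) * f z)"
    by (rule sum.swap_restrict[OF fin fin])
  also have "\<dots> = (\<Sum>z \<in> ?U x. of_int (\<Sum>y \<in> ?I z. mobius P x y) * f z)"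
    by (simp add: sum_distrib_right conj_assoc)
  also have "\<dots> = (\<Sum>z \<in> ?U x. if z = x then f z else 0)"
    by (rule sum.cong) (use mobius_sum_interval[OF P x] in auto)
  also have "\<dots> = f x" using fin x by (simp add: sum.delta)
  finally show ?thesis .
qed

theorem proposition3p9:
  fixes G :: "('a, 'b) monoid_scheme" and K :: "'a set"
  assumes "group G" and "finite (carrier G)" and "subgroup K G"
  shows "1 / of_nat (card K) =
    (\<Sum>H \<in> {H. subgroup H G \<and> K \<subseteq> H}. of_int (mobius (subgroup_lattice G) K H) * b_sub G H)"
proof -
  have "K \<in> carrier (subgroup_lattice G)"
    using assms(3) by (simp add: subgroup_lattice_def)
  note inv = mobius_inversion_above[OF partial_order_subgroup_lattice[OF assms(1)]
      finite_subgroup_lattice[OF assms(2)] this, where f = "\<lambda>H. 1 / of_nat (card H) :: rat"]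
  have [simp]: "carrier (subgroup_lattice G) = {H. subgroup H G}"
    "H \<sqsubseteq>\<^bsub>subgroup_lattice G\<^esub> L \<longleftrightarrow> H \<subseteq> L" for H L
    by (simp_all add: subgroup_lattice_def)
  show ?thesis using inv by (simp add: b_sub_def)
qed

end
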